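(* Let the real data, the derived matrices $\hat A,\tilde B,\hat B,\hat R,\hat C,\hat Z$, the shifts grouped into $N$ blocks with representatives $\alpha_1,\dots,\alpha_N\in\mathbb C_-$, the Riccati-ADI quantities $w_i,\tilde x_i,W^{(i)},\tilde X^{(i)},L_w^{(i)},C_\perp^{(i)}$, $\hat B_r^{(i)}=(W^{(i)})^\top\hat B$, $\hat C_r^{(i)}=L_w^{(i)}\tilde X^{(i)}$, and the Lyapunov-ADI quantities $v_i,z_i,\mathcal C_\perp^{(i)},s_{\mathrm{lyap}}^{(i)},l_{\mathrm{lyap}}^{(i)},S_{\mathrm{lyap}}^{(i)},L_{\mathrm{lyap}}^{(i)},Z_{\mathrm{lyap}}^{(i)}$ be as in the context (all being well defined), where $Z_{\mathrm{lyap}}^{(i)}$ satisfies, for every $i$, $$A^\top Z_{\mathrm{lyap}}^{(i)}-E^\top Z_{\mathrm{lyap}}^{(i)}S_{\mathrm{lyap}}^{(i)}+\hat C^\top L_{\mathrm{lyap}}^{(i)}=0,\qquad A^\top Z_{\mathrm{lyap}}^{(i)}+E^\top Z_{\mathrm{lyap}}^{(i)}(S_{\mathrm{lyap}}^{(i)})^\top+(\mathcal C_\perp^{(i)})^\top L_{\mathrm{lyap}}^{(i)}=0 .$$ For $i=1,\dots,N$ put $\bar B_{\mathrm{lyap}}^{(i)}=(Z_{\mathrm{lyap}}^{(i)})^\top\tilde B$, $\hat B_{\mathrm{lyap}}^{(i)}=(Z_{\mathrm{lyap}}^{(i)})^\top\hat B$, and define recursively, starting from the empty matrix $T_{\mathrm{radi}}^{(0)}$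 and assuming that the inverse below exists at each step, $$t_i=\Big(-(S_{\mathrm{lyap}}^{(i)})^\top+(L_{\mathrm{lyap}}^{(i)})^\top\hat Z(\bar B_{\mathrm{lyap}}^{(i)})^\top-\begin{bmatrix}T_{\mathrm{radi}}^{(i-1)}\\0\end{bmatrix}\tilde X^{(i-1)}\hat B_r^{(i-1)}\hat R^{-1}(\hat B_{\mathrm{lyap}}^{(i)})^\top+\alpha_iI\Big)^{-1}\Big((L_{\mathrm{lyap}}^{(i)})^\top-\begin{bmatrix}T_{\mathrm{radi}}^{(i-1)}\\0\end{bmatrix}(\hat C_r^{(i-1)})^\top\Big)\hat Z,$$ $$t_{\mathrm{radi}}^{(i)}=\begin{bmatrix}t_1^{(i)}\\t_2^{(i)}\end{bmatrix}=\begin{cases}t_i,&\mathrm{Im}(\alpha_i)=0,\\ \begin{bmatrix}\mathrm{Re}(t_i)&\mathrm{Im}(t_i)\end{bmatrix},&\mathrm{Im}(\alpha_i)\ne0,\end{cases}\qquad T_{\mathrm{radi}}^{(i)}=\begin{bmatrix}T_{\mathrm{radi}}^{(i-1)}&t_1^{(i)}\\0&t_2^{(i)}\end{bmatrix},$$ where $t_1^{(i)}$ has as many rows as $Z_{\mathrm{lyap}}^{(i-1)}$ has columns and $t_2^{(i)}$ as many rows as $z_i$ has columns. Then for every $i=1,\dots,N$, $$w_i=Z_{\mathrm{lyap}}^{(i)}t_{\mathrm{radi}}^{(i)}\qquad\text{and}\qquad W^{(i)}=Z_{\mathrm{lyap}}^{(i)}T_{\mathrm{radi}}^{(i)} .$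$
   Context: Data. $E,A\in\mathbb R^{n\times n}$, $B_1\in\mathbb R^{n\times m_1}$, $B_2\in\mathbb R^{n\times m_2}$, $C_1\in\mathbb R^{p\times n}$, $C_2\in\mathbb R^{m_1\times n}$; $R_1\in\mathbb R^{m_1\times m_1}$ and $R_2\in\mathbb R^{m_2\times m_2}$ are symmetric and invertible; $Z\in\mathbb R^{p\times p}$ is symmetric (no definiteness is required). Derived matrices. $\tilde B=[0\ \ B_1]\in\mathbb R^{n\times(p+m_1)}$ (zero block of size $n\times p$), $\hat B=[B_1\ \ B_2]$, $\hat R=\mathrm{blkdiag}(R_1,-R_2)$, $\hat C=\begin{bmatrix}C_1\\C_2\end{bmatrix}$, $\hat Z=\mathrm{blkdiag}(Z,-R_1^{-1})$, $\hat A=A+\tilde B\hat Z\hat C=A-B_1R_1^{-1}C_2$. Shifts. The ADI shifts lie in $\mathbb C_-=\{z:\mathrm{Re}\,z<0\}$; non-real shifts occur in adjacent complex-conjugate pairs. The list of shifts is split into $N$ blocks, each block being either one real shift or one conjugate pair; $\alpha_i$ denotes the real shift, respectively one chosen member of the pair, of block $i$. All superscripts $(i)$ count blocks. Let $q=p+m_1$ and $I_q$ the $q\times q$ identity. Terms containing empty matrices (index $0$) are zero. Riccati-ADI quantities. If $\alpha_i$ is real: $s_w^{(i)}=-\alpha_iI_q$, $l_w^{(i)}=-I_q$. If $\alpha_i$ is non-real: $$s_w^{(i)}=\begin{bmatrix}-\mathrm{Re}(\alpha_i)I_q&-\mathrm{Im}(\alpha_i)I_q\\ \mathrm{Im}(\alpha_i)I_q&-\mathrm{Re}(\alpha_i)I_q\end{bmatrix},\qquad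 l_w^{(i)}=\begin{bmatrix}-I_q&0\end{bmatrix}.$$ Start from empty $W^{(0)},\tilde X^{(0)},L_w^{(0)}$ and $C_\perp^{(0)}=\hat C$. For $i=1,\dots,N$, the real matrix $w_i$ is the solution (assumed to be unique) of $$\Big(\hat A-\hat B\hat R^{-1}\hat B^\top W^{(i-1)}\tilde X^{(i-1)}(W^{(i-1)})^\top E\Big)^\top w_i-E^\top w_is_w^{(i)}+(C_\perp^{(i-1)})^\top\hat Zl_w^{(i)}=0,$$ $\tilde x_i$ is the inverse (assumed to exist) of the unique solution $(\tilde x_i)^{-1}$ of $$-(s_w^{(i)})^\top(\tilde x_i)^{-1}-(\tilde x_i)^{-1}s_w^{(i)}+(l_w^{(i)})^\top\hat Zl_w^{(i)}+w_i^\top\hat B\hat R^{-1}\hat B^\top w_i=0,$$ and $L_w^{(i)}=[L_w^{(i-1)}\ \ l_w^{(i)}]$, $W^{(i)}=[W^{(i-1)}\ \ w_i]$, $\tilde X^{(i)}=\mathrm{blkdiag}(\tilde X^{(i-1)},\tilde x_i)$, $C_\perp^{(i)}=\hat C-L_w^{(i)}\tilde X^{(i)}(W^{(i)})^\top E=C_\perp^{(i-1)}-l_w^{(i)}\tilde x_iw_i^\top E$. Lyapunov-ADI quantities. Let $\gamma_i=\sqrt{-2\,\mathrm{Re}(\alpha_i)}$ and, for non-real $\alpha_i$, $\delta_i=\mathrm{Re}(\alpha_i)/\mathrm{Im}(\alpha_i)$. Start from $\mathcal C_\perp^{(0)}=\hat C$ and empty $S_{\mathrm{lyap}}^{(0)},L_{\mathrm{lyap}}^{(0)},Z_{\mathrm{lyap}}^{(0)}$.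 For $i=1,\dots,N$ put $v_i=(A^\top+\alpha_iE^\top)^{-1}(\mathcal C_\perp^{(i-1)})^\top$ (the inverse is assumed to exist). If $\alpha_i$ is real: $s_{\mathrm{lyap}}^{(i)}=-\alpha_iI_q$, $l_{\mathrm{lyap}}^{(i)}=-\gamma_iI_q$, $z_i=\gamma_iv_i$, $\mathcal C_\perp^{(i)}=\mathcal C_\perp^{(i-1)}+\gamma_i^2v_i^\top E$. If $\alpha_i$ is non-real: $$s_{\mathrm{lyap}}^{(i)}=\gamma_i^2\begin{bmatrix}I_q&\frac{\sqrt{1+\delta_i^2}}{2\delta_i}I_q\\-\frac{\sqrt{1+\delta_i^2}}{2\delta_i}I_q&0\end{bmatrix},\qquad l_{\mathrm{lyap}}^{(i)}=-\sqrt2\,\gamma_i\begin{bmatrix}I_q&0\end{bmatrix},$$ $$z_i=\begin{bmatrix}\sqrt2\,\gamma_i\big(\mathrm{Re}(v_i)+\delta_i\mathrm{Im}(v_i)\big)&\sqrt2\,\gamma_i\sqrt{\delta_i^2+1}\,\mathrm{Im}(v_i)\end{bmatrix},\qquad \mathcal C_\perp^{(i)}=\mathcal C_\perp^{(i-1)}+2\gamma_i^2\big(\mathrm{Re}(v_i)+\delta_i\mathrm{Im}(v_i)\big)^\top E.$$ In both cases $$S_{\mathrm{lyap}}^{(i)}=\begin{bmatrix}S_{\mathrm{lyap}}^{(i-1)}&(L_{\mathrm{lyap}}^{(i-1)})^\top l_{\mathrm{lyap}}^{(i)}\\0&s_{\mathrm{lyap}}^{(i)}\end{bmatrix},\quad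 L_{\mathrm{lyap}}^{(i)}=[L_{\mathrm{lyap}}^{(i-1)}\ \ l_{\mathrm{lyap}}^{(i)}],\quad Z_{\mathrm{lyap}}^{(i)}=[Z_{\mathrm{lyap}}^{(i-1)}\ \ z_i].$$ *)

theory Defs
  imports Complex_Main "Jordan_Normal_Form.Gauss_Jordan_Elimination"
begin

(* Matrices are those of Jordan_Normal_Form.Matrix, whose dimensions are natural numbers (possibly 0).
   A product over an empty inner dimension is a zero matrix, so every term built from the empty
   matrices with index 0 vanishes. *)

definition append_cols :: "'a :: zero mat \<Rightarrow> 'a mat \<Rightarrow> 'a mat" (infixr \<open>@\<^sub>c\<close> 65) where
  "A @\<^sub>c B = four_block_mat A B (0\<^sub>m 0 (dim_col A)) (0\<^sub>m 0 (dim_col B))"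

(* Meaningful only for invertible matrices (see inv_mat_correct); invertibility is always assumed separately. *)
definition inv_mat :: "'a :: field mat \<Rightarrow> 'a mat" where
  "inv_mat A = the (mat_inverse A)"

lemma inv_mat_correct:
  fixes A :: "'a :: field mat"
  assumes A: "A \<in> carrier_mat n n" and inv: "invertible_mat A"
  shows "inv_mat A \<in> carrier_mat n n" "A * inv_mat A = 1\<^sub>m n" "inv_mat A * A = 1\<^sub>m n"
proof -
  from inv obtain B where B: "A * B = 1\<^sub>m (dim_row A)" "B * A = 1\<^sub>m (dim_row B)"
    unfolding invertible_mat_def inverts_mat_def by auto
  have "dim_col B = n" using arg_cong[OF B(1), of dim_col] A by simp
  moreover have "dim_row B = n" using arg_cong[OF B(2), of dim_col] A by simp
  ultimately have "A \<in> Units (ring_mat TYPE('a) n ())"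
    using A B unfolding Units_def ring_mat_def by auto
  then obtain C where C: "mat_inverse A = Some C"
    using mat_inverse(1)[OF A, where b = "()"] by (cases "mat_inverse A") auto
  show "inv_mat A \<in> carrier_mat n n" "A * inv_mat A = 1\<^sub>m n" "inv_mat A * A = 1\<^sub>m n"
    using mat_inverse(2)[OF A C] C unfolding inv_mat_def by auto
qed

abbreviation cmat :: "real mat \<Rightarrow> complex mat" where
  "cmat \<equiv> map_mat complex_of_real"

abbreviation Re_mat :: "complex mat \<Rightarrow> real mat" where
  "Re_mat \<equiv> map_mat Re"

abbreviation Im_mat :: "complex mat \<Rightarrow> real mat" where
  "Im_mat \<equiv> map_mat Im"

(* In what follows a is the representative of a block of shifts, which is the single shift a
   if Im a = 0 and the conjugate pair of a and cnj a otherwise. *)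

definition s_radi :: "nat \<Rightarrow> complex \<Rightarrow> real mat" where
  "s_radi q a =
     (if Im a = 0 then (- Re a) \<cdot>\<^sub>m 1\<^sub>m q
      else four_block_mat ((- Re a) \<cdot>\<^sub>m 1\<^sub>m q) ((- Im a) \<cdot>\<^sub>m 1\<^sub>m q)
                          (Im a \<cdot>\<^sub>m 1\<^sub>m q)     ((- Re a) \<cdot>\<^sub>m 1\<^sub>m q))"

definition l_radi :: "nat \<Rightarrow> complex \<Rightarrow> real mat" where
  "l_radi q a = (if Im a = 0 then - 1\<^sub>m q else (- 1\<^sub>m q) @\<^sub>c 0\<^sub>m q q)"

definition adi_gamma :: "complex \<Rightarrow> real" where
  "adi_gamma a = sqrt (- 2 * Re a)"

definition adi_delta :: "complex \<Rightarrow> real" where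
  "adi_delta a = Re a / Im a"

definition s_lyap :: "nat \<Rightarrow> complex \<Rightarrow> real mat" where
  "s_lyap q a =
     (if Im a = 0 then (- Re a) \<cdot>\<^sub>m 1\<^sub>m q
      else (let k = sqrt (1 + (adi_delta a)^2) / (2 * adi_delta a)
            in (adi_gamma a)^2 \<cdot>\<^sub>m four_block_mat (1\<^sub>m q)          (k \<cdot>\<^sub>m 1\<^sub>m q)
                                               ((- k) \<cdot>\<^sub>m 1\<^sub>m q) (0\<^sub>m q q)))"

definition l_lyap :: "nat \<Rightarrow> complex \<Rightarrow> real mat" where
  "l_lyap q a =
     (if Im a = 0 then (- adi_gamma a) \<cdot>\<^sub>m 1\<^sub>m q
      else (- (sqrt 2 * adi_gamma a)) \<cdot>\<^sub>m (1\<^sub>m q @\<^sub>c 0\<^sub>m q q))"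

end

(* The Lyapunov-ADI equation A^T Z + E^T Z S^T + Cl^T L = 0 turns the linear system defining t_i, multiplied
   from the left by E^T Z, into the Riccati-ADI equation for Z t_i, up to the term
   Cl^T (L t_i - Zh Bt^T Z t_i + Zh). The second factor vanishes: since S + S^T = L^T L, the last block row of
   the system for t_i says that l^T times this factor lies in the image of a block Sylvester operator
   u -> s_lyap u - u s_radi, whose range meets that of l^T only in 0. The uniqueness of w_i then gives
   w_i = Z t_i. Complex systems are rewritten as real ones in the unknown [Re t, Im t]. *)

theory Submission
  imports Defs
begin

text \<open>The obstacle is that the Sylvester operator u -> s_lyap u - u s_radi is singular: both
  shift blocks have the eigenvalues -a and -cnj a, and for a real shift the operator is even zero.
  The last block row of the system therefore does not determine the lower part \<open>t2\<close> of
  t_i. It determines only the residual factor, because l^T is injective and the image of l^T lies in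
  the first q rows, where the range of the operator leaves no room for it. Only the last block row
  is examined because the previous transformation enters the system padded by zero rows. That row
  therefore contains no trace of earlier Riccati steps, although the full system depends on all of
  them. Two facts are not part of the recursions and have to be derived. The matrix
  \<open>X i\<close> is symmetric, without which the low-rank corrections in the two equations would
  be transposes of each other instead of equal; this follows from uniqueness of the small Lyapunov
  solutions. The Lyapunov residual has the closed form Ch - L Z^T E, whose second term produces
  exactly the L^T L t needed to cancel.\<close>

section \<open>Matrix algebra with side conditions on dimensions\<close>

lemma mat_assoc_dim:
  fixes A :: "'a :: semiring_0 mat"
  shows "dim_col A = dim_row B \<Longrightarrow> dim_col B = dim_row C \<Longrightarrow> A * B * C = A * (B * C)"
  by (rule assoc_mult_mat) auto

lemma mat_distrib_dim:
  fixes A :: "'a :: ring mat"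
  shows "dim_row A = dim_row B \<Longrightarrow> dim_col A = dim_col B \<Longrightarrow> dim_col A = dim_row C \<Longrightarrow>
      (A + B) * C = A * C + B * C"
    and "dim_row A = dim_row B \<Longrightarrow> dim_col A = dim_col B \<Longrightarrow> dim_col A = dim_row C \<Longrightarrow>
      (A - B) * C = A * C - B * C"
    and "dim_row A = dim_row B \<Longrightarrow> dim_col A = dim_col B \<Longrightarrow> dim_col D = dim_row A \<Longrightarrow>
      D * (A + B) = D * A + D * B"
    and "dim_row A = dim_row B \<Longrightarrow> dim_col A = dim_col B \<Longrightarrow> dim_col D = dim_row A \<Longrightarrow>
      D * (A - B) = D * A - D * B"
  by ((rule add_mult_distrib_mat minus_mult_distrib_mat mult_add_distrib_mat mult_minus_distrib_mat;
      rule carrier_matI; simp)+)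

lemma mat_uminus_mult_dim:
  fixes A :: "'a :: ring mat"
  shows "dim_col A = dim_row B \<Longrightarrow> - A * B = - (A * B)"
    and "dim_col A = dim_row B \<Longrightarrow> A * - B = - (A * B)"
  by auto

lemma mat_transpose_dim:
  fixes A :: "'a :: comm_ring mat"
  shows "dim_col A = dim_row C \<Longrightarrow> (A * C)\<^sup>T = C\<^sup>T * A\<^sup>T"
    and "dim_row A = dim_row B \<Longrightarrow> dim_col A = dim_col B \<Longrightarrow> (A + B)\<^sup>T = A\<^sup>T + B\<^sup>T"
    and "dim_row A = dim_row B \<Longrightarrow> dim_col A = dim_col B \<Longrightarrow> (A - B)\<^sup>T = A\<^sup>T - B\<^sup>T"
  by ((rule transpose_mult transpose_add transpose_minus; rule carrier_matI; simp)+)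

lemma transpose_smult: "(c \<cdot>\<^sub>m A)\<^sup>T = c \<cdot>\<^sub>m A\<^sup>T"
  by auto

text \<open>Expands an expression into a sum of right-nested products. The side conditions are
  equations between dimensions, which the simplifier can decide; memberships in
  \<open>carrier_mat\<close> would bring in dimension variables that do not occur in the term being
  rewritten.\<close>

lemmas mat_normalize = mat_assoc_dim mat_distrib_dim mat_uminus_mult_dim mat_transpose_dim transpose_uminus

section \<open>Block matrices\<close>

lemma dim_append_cols [simp]:
  "dim_row (A @\<^sub>c B) = dim_row A" "dim_col (A @\<^sub>c B) = dim_col A + dim_col B"
  by (simp_all add: append_cols_def)

lemma append_cols_carrier [simp]:
  "A \<in> carrier_mat n a \<Longrightarrow> B \<in> carrier_mat n b \<Longrightarrow> A @\<^sub>c B \<in> carrier_mat n (a + b)"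
  by auto

lemma mult_append_cols:
  fixes A :: "'a :: semiring_0 mat"
  assumes "A \<in> carrier_mat k n" "B \<in> carrier_mat n b" "C \<in> carrier_mat n c"
  shows "A * (B @\<^sub>c C) = A * B @\<^sub>c A * C"
proof (rule eq_matI)
  fix i j assume "i < dim_row (A * B @\<^sub>c A * C)" "j < dim_col (A * B @\<^sub>c A * C)"
  with assms show "(A * (B @\<^sub>c C)) $$ (i, j) = (A * B @\<^sub>c A * C) $$ (i, j)"
    by (auto simp: append_cols_def scalar_prod_def)
qed (use assms in auto)

text \<open>Both concatenations are 2-by-2 block matrices with an empty block row or block column,
  so three of the four blocks of their product are empty.\<close>

lemma append_cols_mult_append_rows:
  fixes A :: "'a :: comm_ring_1 mat"
  assumes A: "A \<in> carrier_mat n a" and B: "B \<in> carrier_mat n b"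
    and P: "P \<in> carrier_mat a c" and Q: "Q \<in> carrier_mat b c"
  shows "(A @\<^sub>c B) * (P @\<^sub>r Q) = A * P + B * Q"
proof -
  have "(A @\<^sub>c B) * (P @\<^sub>r Q) = four_block_mat (A * P + B * Q) (0\<^sub>m n 0) (0\<^sub>m 0 c) (0\<^sub>m 0 0)"
    using A B P Q unfolding append_cols_def append_rows_def
    by (subst mult_four_block_mat[of _ n a _ b _ 0 _ _ c _ 0]) (auto intro!: cong_four_block_mat)
  also have "\<dots> = A * P + B * Q"
    using A B P Q by (intro eq_matI) (auto simp del: index_mult_mat(1))
  finally show ?thesis .
qed

lemma append_cols_mult_four_block:
  fixes A :: "'a :: comm_ring_1 mat"
  assumes A: "A \<in> carrier_mat n a" and B: "B \<in> carrier_mat n b"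
    and P: "P \<in> carrier_mat a c" and Q: "Q \<in> carrier_mat a d"
    and R: "R \<in> carrier_mat b c" and S: "S \<in> carrier_mat b d"
  shows "(A @\<^sub>c B) * four_block_mat P Q R S = (A * P + B * R) @\<^sub>c (A * Q + B * S)"
  using A B P Q R S unfolding append_cols_def
  by (subst mult_four_block_mat[of _ n a _ b _ 0 _ _ c _ d]) (auto intro!: cong_four_block_mat)

lemma four_block_mat_inj:
  assumes "four_block_mat A B C D = four_block_mat A' B' C' D'"
    and "A \<in> carrier_mat a c" "B \<in> carrier_mat a d" "C \<in> carrier_mat b c" "D \<in> carrier_mat b d"
    and "A' \<in> carrier_mat a c" "B' \<in> carrier_mat a d" "C' \<in> carrier_mat b c" "D' \<in> carrier_mat b d"
  shows "A = A'" "B = B'" "C = C'" "D = D'"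
proof -
  have e: "four_block_mat A B C D $$ (i, j) = four_block_mat A' B' C' D' $$ (i, j)" for i j
    using assms(1) by simp
  show "A = A'"
  proof (rule eq_matI)
    fix i j assume "i < dim_row A'" "j < dim_col A'"
    with assms(2-) e[of i j] show "A $$ (i, j) = A' $$ (i, j)" by auto
  qed (use assms(2-) in auto)
  show "B = B'"
  proof (rule eq_matI)
    fix i j assume "i < dim_row B'" "j < dim_col B'"
    with assms(2-) e[of i "c + j"] show "B $$ (i, j) = B' $$ (i, j)" by auto
  qed (use assms(2-) in auto)
  show "C = C'"
  proof (rule eq_matI)
    fix i j assume "i < dim_row C'" "j < dim_col C'"
    with assms(2-) e[of "a + i" j] show "C $$ (i, j) = C' $$ (i, j)" by auto
  qed (use assms(2-) in auto)
  show "D = D'"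
  proof (rule eq_matI)
    fix i j assume "i < dim_row D'" "j < dim_col D'"
    with assms(2-) e[of "a + i" "c + j"] show "D $$ (i, j) = D' $$ (i, j)" by auto
  qed (use assms(2-) in auto)
qed

section \<open>The Riccati-ADI equation from the Lyapunov-ADI equation\<close>

text \<open>In the application \<open>V\<close> is the current Lyapunov basis, and \<open>T\<close>
  is the previous transformation padded with zero rows, so that \<open>VT\<close> recovers the
  previous Riccati basis \<open>W\<close>. In the sum of \<open>lyap\<close> times \<open>t\<close>
  and E^T V times \<open>teq\<close> the terms with S^T cancel. Then \<open>res\<close> replaces
  each \<open>L * t\<close>, which removes the terms starting with E^T V L^T and turns C^T L t into
  the contributions of B Q C and of C^T Q lw.\<close>

lemma riccati_adi_from_lyapunov:
  fixes E :: "'a :: comm_ring_1 mat"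
  assumes car: "E \<in> carrier_mat n n" "A \<in> carrier_mat n n" "B \<in> carrier_mat n q"
      "H \<in> carrier_mat n m" "G \<in> carrier_mat m m" "C \<in> carrier_mat q n" "Q \<in> carrier_mat q q"
      "W \<in> carrier_mat n r" "X \<in> carrier_mat r r" "Lw \<in> carrier_mat q r"
      "V \<in> carrier_mat n k" "S \<in> carrier_mat k k" "L \<in> carrier_mat q k"
      "T \<in> carrier_mat k r" "t \<in> carrier_mat k d" "sw \<in> carrier_mat d d" "lw \<in> carrier_mat q d"
    and sym: "G\<^sup>T = G" "Q\<^sup>T = Q" "X\<^sup>T = X"
    and VT: "V * T = W"
    and lyap: "A\<^sup>T * V + E\<^sup>T * V * S\<^sup>T + (C - L * V\<^sup>T * E)\<^sup>T * L = 0\<^sub>m n k"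
    and teq: "(- S\<^sup>T + L\<^sup>T * Q * (V\<^sup>T * B)\<^sup>T - T * X * (W\<^sup>T * H) * G * (V\<^sup>T * H)\<^sup>T) * t
        - t * sw + (L\<^sup>T - T * (Lw * X)\<^sup>T) * Q * lw = 0\<^sub>m k d"
    and res: "L * t = Q * B\<^sup>T * V * t + Q * lw"
  shows "(A + B * Q * C - H * G * H\<^sup>T * W * X * W\<^sup>T * E)\<^sup>T * (V * t)
      - E\<^sup>T * (V * t) * sw + (C - Lw * X * W\<^sup>T * E)\<^sup>T * Q * lw = 0\<^sub>m n d"
proof -
  note [simp] = car[THEN carrier_matD(1)] car[THEN carrier_matD(2)] sym
  note [simp del] = assoc_mult_mat index_mult_mat(1)
  \<comment> \<open>Right-nesting hides \<open>V * T\<close> inside longer products, so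
    \<open>VT\<close> is restated with a trailing factor.\<close>
  have VT': "V * (T * P) = W * P" if "dim_row P = r" for P
    using that VT by (simp flip: mat_assoc_dim)
  have 1: "(A\<^sup>T * V + E\<^sup>T * V * S\<^sup>T + (C - L * V\<^sup>T * E)\<^sup>T * L) * t = 0\<^sub>m n d"
    by (simp add: lyap)
  have 2: "E\<^sup>T * (V * ((- S\<^sup>T + L\<^sup>T * Q * (V\<^sup>T * B)\<^sup>T - T * X * (W\<^sup>T * H) * G * (V\<^sup>T * H)\<^sup>T) * t
        - t * sw + (L\<^sup>T - T * (Lw * X)\<^sup>T) * Q * lw)) = 0\<^sub>m n d"
    unfolding teq by simp
  show ?thesis
  \<comment> \<open>Matrices of unspecified size form no ring type, so the cancellation is done on a
    single entry, where \<open>algebra_simps\<close> applies to the sums.\<close>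
  proof (rule eq_matI)
    fix i j assume "i < dim_row (0\<^sub>m n d :: 'a mat)" "j < dim_col (0\<^sub>m n d :: 'a mat)"
    then have [simp]: "i < n" "j < d" by auto
    note sum0 = arg_cong2[of _ _ _ _ "(+)", OF 1[THEN arg_cong[of _ _ "\<lambda>M. M $$ (i, j)"]]
      2[THEN arg_cong[of _ _ "\<lambda>M. M $$ (i, j)"]]]
    show "((A + B * Q * C - H * G * H\<^sup>T * W * X * W\<^sup>T * E)\<^sup>T * (V * t)
      - E\<^sup>T * (V * t) * sw + (C - Lw * X * W\<^sup>T * E)\<^sup>T * Q * lw) $$ (i, j) = (0\<^sub>m n d :: 'a mat) $$ (i, j)"
      using sum0 by (simp add: mat_normalize VT' res algebra_simps)
  qed simp_all
qed

section \<open>Block-diagonal matrices, symmetry and inverses\<close>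

lemma index_append_cols [simp]:
  assumes "i < dim_row A" "dim_row B = dim_row A" "j < dim_col A + dim_col B"
  shows "(A @\<^sub>c B) $$ (i, j) = (if j < dim_col A then A $$ (i, j) else B $$ (i, j - dim_col A))"
  using assms by (simp add: append_cols_def)

lemma transpose_append_cols:
  assumes "dim_row A = dim_row B"
  shows "(A @\<^sub>c B)\<^sup>T = A\<^sup>T @\<^sub>r B\<^sup>T"
  using assms by (auto simp: append_cols_def append_rows_def)

lemma append_cols_mult_transpose:
  fixes A :: "'a :: comm_ring_1 mat"
  assumes "A \<in> carrier_mat n a" "B \<in> carrier_mat n b" "C \<in> carrier_mat m a" "D \<in> carrier_mat m b"
  shows "(A @\<^sub>c B) * (C @\<^sub>c D)\<^sup>T = A * C\<^sup>T + B * D\<^sup>T"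
  using assms by (simp add: transpose_append_cols append_cols_mult_append_rows[of A n a B b _ m])

lemma diag_block_mat_two: "diag_block_mat [A, B] =
    four_block_mat A (0\<^sub>m (dim_row A) (dim_col B)) (0\<^sub>m (dim_row B) (dim_col A)) B"
proof -
  \<comment> \<open>The recursion of \<open>diag_block_mat\<close> ends in the 0-by-0 matrix of the
    empty list, which surrounds the last block with empty blocks.\<close>
  have "four_block_mat B (0\<^sub>m (dim_row B) 0) (0\<^sub>m 0 (dim_col B)) (0\<^sub>m 0 0) = B"
    by auto
  then show ?thesis by (simp add: Let_def)
qed

lemma diag_block_mat_two_sym:
  assumes "A \<in> carrier_mat a a" "A\<^sup>T = A" "B \<in> carrier_mat b b" "B\<^sup>T = B"
  shows "diag_block_mat [A, B] \<in> carrier_mat (a + b) (a + b)"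
    and "(diag_block_mat [A, B])\<^sup>T = diag_block_mat [A, B]"
  using assms unfolding diag_block_mat_two by (auto simp: transpose_four_block_mat[of _ a a _ b _ b])

lemma invertible_matI:
  assumes "A \<in> carrier_mat n n" "B \<in> carrier_mat n n" "A * B = 1\<^sub>m n" "B * A = 1\<^sub>m n"
  shows "invertible_mat A"
  using assms unfolding invertible_mat_def inverts_mat_def by auto

lemma invertible_diag_block_mat:
  fixes A :: "'a :: field mat"
  assumes A: "A \<in> carrier_mat a a" "invertible_mat A" and B: "B \<in> carrier_mat b b" "invertible_mat B"
  shows "invertible_mat (diag_block_mat [A, B])"
proof -
  note A' = inv_mat_correct[OF A] and B' = inv_mat_correct[OF B]
  show ?thesis
    unfolding diag_block_mat_two
    by (rule invertible_matI[of _ "a + b" "four_block_mat (inv_mat A) (0\<^sub>m a b) (0\<^sub>m b a) (inv_mat B)"])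
       (use A(1) B(1) A' B' in \<open>auto simp: mult_four_block_mat[of _ a a _ b _ b _ _ a _ b]\<close>)
qed

lemma invertible_mat_uminus:
  fixes A :: "'a :: field mat"
  assumes A: "A \<in> carrier_mat n n" "invertible_mat A"
  shows "invertible_mat (- A)"
  by (rule invertible_matI[of _ n "- inv_mat A"]) (use A inv_mat_correct[OF A] in auto)

lemma inv_mat_sym:
  fixes A :: "'a :: field mat"
  assumes A: "A \<in> carrier_mat n n" "invertible_mat A" and sym: "A\<^sup>T = A"
  shows "(inv_mat A)\<^sup>T = inv_mat A"
proof -
  note I = inv_mat_correct[OF A]
  have "(inv_mat A)\<^sup>T * A = (A * inv_mat A)\<^sup>T"
    using transpose_mult[OF A(1) I(1)] sym by simp
  then have "(inv_mat A)\<^sup>T * A = 1\<^sub>m n" using I by simp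
  then have "(inv_mat A)\<^sup>T * (A * inv_mat A) = inv_mat A"
    using A(1) I(1) by (simp flip: assoc_mult_mat)
  then show ?thesis using I by simp
qed

lemma inv_mat_mult_solves:
  fixes M :: "'a :: field mat"
  assumes "M \<in> carrier_mat n n" "invertible_mat M" "R \<in> carrier_mat n m" "t = inv_mat M * R"
  shows "t \<in> carrier_mat n m" "M * t = R"
  using inv_mat_correct[OF assms(1,2)] assms by (auto simp flip: assoc_mult_mat)

section \<open>The blocks belonging to one shift or one conjugate pair\<close>

text \<open>The Riccati and the Lyapunov blocks have the same width \<open>d\<close>, so both bases
  grow by equally many columns and the transformation between them stays square.\<close>

lemma block_carriers:
  fixes a :: complex and q :: nat
  defines "d \<equiv> dim_col (l_radi q a)"
  shows "d = (if Im a = 0 then q else q + q)"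
    and "l_radi q a \<in> carrier_mat q d" "s_radi q a \<in> carrier_mat d d"
    and "l_lyap q a \<in> carrier_mat q d" "s_lyap q a \<in> carrier_mat d d"
  unfolding d_def by (auto simp: l_radi_def s_radi_def l_lyap_def s_lyap_def Let_def)

text \<open>Multiplication by \<^term>\<open>s_radi q a\<close> from the right is, on the real and imaginary parts of a
  complex matrix, multiplication by the scalar \<open>- a\<close>.\<close>

lemma shifted_system_real_form:
  fixes M R :: "real mat"
  assumes M: "M \<in> carrier_mat k k" and R: "R \<in> carrier_mat k q" and t: "t \<in> carrier_mat k q"
    and eq: "(cmat M + a \<cdot>\<^sub>m 1\<^sub>m k) * t = cmat R"
    and tr: "Im a = 0 \<Longrightarrow> cmat tr = t" "Im a \<noteq> 0 \<Longrightarrow> tr = Re_mat t @\<^sub>c Im_mat t"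
  shows "tr \<in> carrier_mat k (dim_col (l_radi q a))"
    and "M * tr - tr * s_radi q a + R * l_radi q a = 0\<^sub>m k (dim_col (l_radi q a))"
proof -
  have "(cmat M + a \<cdot>\<^sub>m 1\<^sub>m k) * t = cmat M * t + a \<cdot>\<^sub>m t"
    using M t by (simp add: add_mult_distrib_mat[of _ k k] mult_smult_assoc_mat[of _ k k])
  with eq have "cmat M * t + a \<cdot>\<^sub>m t = cmat R" by simp
  then have e: "(cmat M * t + a \<cdot>\<^sub>m t) $$ (i, j) = cmat R $$ (i, j)" for i j by simp
  have re: "(M * Re_mat t) $$ (i, j) = R $$ (i, j) - (Re a * Re (t $$ (i, j)) - Im a * Im (t $$ (i, j)))"
    and im: "(M * Im_mat t) $$ (i, j) = - (Re a * Im (t $$ (i, j)) + Im a * Re (t $$ (i, j)))"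
    if "i < k" "j < q" for i j
    using that M R t e[of i j, THEN arg_cong[of _ _ Re]] e[of i j, THEN arg_cong[of _ _ Im]]
    by (simp_all add: scalar_prod_def algebra_simps)
  show c: "tr \<in> carrier_mat k (dim_col (l_radi q a))"
  proof (cases "Im a = 0")
    case True
    with tr(1)[THEN arg_cong[of _ _ dim_row]] tr(1)[THEN arg_cong[of _ _ dim_col]] t
    show ?thesis by (auto simp: l_radi_def)
  next
    case False
    with tr(2) t show ?thesis by (auto simp: l_radi_def)
  qed
  show "M * tr - tr * s_radi q a + R * l_radi q a = 0\<^sub>m k (dim_col (l_radi q a))"
  proof (cases "Im a = 0")
    case True
    from tr(1)[OF True] have "tr = Re_mat t" by auto
    moreover have "tr * s_radi q a = (- Re a) \<cdot>\<^sub>m tr" "R * l_radi q a = - R"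
      using True R c by (auto simp: s_radi_def l_radi_def mult_smult_distrib[of _ k q _ q])
    ultimately show ?thesis
      using True re M R t by (intro eq_matI) (auto simp: l_radi_def simp del: index_mult_mat(1) split: if_splits)
  next
    case False
    note tr = tr(2)[OF False]
    have "M * tr = M * Re_mat t @\<^sub>c M * Im_mat t"
      unfolding tr using M t by (intro mult_append_cols) auto
    moreover have "tr * s_radi q a = ((- Re a) \<cdot>\<^sub>m Re_mat t + Im a \<cdot>\<^sub>m Im_mat t)
        @\<^sub>c ((- Im a) \<cdot>\<^sub>m Re_mat t + (- Re a) \<cdot>\<^sub>m Im_mat t)"
      unfolding tr using t False
      by (simp add: s_radi_def append_cols_mult_four_block[of _ k q _ q _ q _ q] mult_smult_distrib[of _ k q _ q])
    \<comment> \<open>The zero block is the vanishing imaginary part of the right-hand side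
      \<open>cmat R\<close>.\<close>
    moreover have "R * l_radi q a = - R @\<^sub>c 0\<^sub>m k q"
      using R False by (simp add: l_radi_def mult_append_cols[of R k q _ q _ q])
    ultimately show ?thesis
      using re im M R t False
      by (intro eq_matI) (auto simp: l_radi_def simp del: index_mult_mat(1))
  qed
qed

text \<open>For a pair the off-diagonal blocks of \<open>s_lyap\<close> are negatives of each other
  and cancel, leaving twice gamma squared in the upper left corner; the factor sqrt 2 in
  \<open>l_lyap\<close> matches this. For a real shift both sides are -2 Re a times the identity, by
  the choice of gamma, which uses that Re a is negative.\<close>

lemma lyap_block_sum:
  assumes "Re a < 0"
  shows "s_lyap q a + (s_lyap q a)\<^sup>T = (l_lyap q a)\<^sup>T * l_lyap q a"
proof (cases "Im a = 0")
  case True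
  have "adi_gamma a * adi_gamma a = - 2 * Re a" using assms by (simp add: adi_gamma_def)
  then show ?thesis using True
    by (intro eq_matI) (auto simp: s_lyap_def l_lyap_def)
next
  case False
  have g: "sqrt 2 * adi_gamma a * (sqrt 2 * adi_gamma a) = 2 * (adi_gamma a)\<^sup>2"
    by (simp add: power2_eq_square)
  have "l_lyap q a = four_block_mat ((- (sqrt 2 * adi_gamma a)) \<cdot>\<^sub>m 1\<^sub>m q) (0\<^sub>m q q) (0\<^sub>m 0 q) (0\<^sub>m 0 q)"
    using False by (auto simp: l_lyap_def append_cols_def)
  moreover from this have "(l_lyap q a)\<^sup>T = four_block_mat ((- (sqrt 2 * adi_gamma a)) \<cdot>\<^sub>m 1\<^sub>m q) (0\<^sub>m q 0) (0\<^sub>m q q) (0\<^sub>m q 0)"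
    by (auto intro!: eq_matI)
  ultimately have "(l_lyap q a)\<^sup>T * l_lyap q a =
    four_block_mat ((2 * (adi_gamma a)\<^sup>2) \<cdot>\<^sub>m 1\<^sub>m q) (0\<^sub>m q q) (0\<^sub>m q q) (0\<^sub>m q q)"
    by (simp add: mult_four_block_mat[of _ q q _ 0 _ q _ _ q _ q] mult_smult_distrib[of _ q q]
        mult_smult_assoc_mat[of _ q q]) (auto simp: g)
  then show ?thesis using False
    by (auto intro!: eq_matI simp: s_lyap_def Let_def)
qed

text \<open>For a conjugate pair the last \<open>q\<close> rows of the hypothesis express the upper half of \<open>u\<close> through the
  lower half, and substituting this into the first \<open>q\<close> rows annihilates them, because
  \<open>k\<^sup>2 = \<bar>a\<bar>\<^sup>2\<close> for the off-diagonal entry \<open>k\<close> of \<^term>\<open>s_lyap q a\<close>.\<close>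

lemma block_kernel:
  fixes y u :: "real mat"
  assumes a: "Re a < 0"
    and y: "y \<in> carrier_mat q (dim_col (l_radi q a))"
    and u: "u \<in> carrier_mat (dim_col (l_radi q a)) (dim_col (l_radi q a))"
    and eq: "(l_lyap q a)\<^sup>T * y = s_lyap q a * u - u * s_radi q a"
  shows "y = 0\<^sub>m q (dim_col (l_radi q a))"
proof (cases "Im a = 0")
  case True
  have g: "adi_gamma a \<noteq> 0" using a by (simp add: adi_gamma_def)
  from True y u have y: "y \<in> carrier_mat q q" and u: "u \<in> carrier_mat q q"
    by (auto simp: l_radi_def)
  \<comment> \<open>For a real shift both blocks are the same scalar matrix, so the right-hand side
    of \<open>eq\<close> vanishes for every \<open>u\<close>.\<close>
  have "s_lyap q a * u = u * s_radi q a"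
    using True u by (simp add: s_lyap_def s_radi_def mult_smult_distrib[of _ q q _ q] mult_smult_assoc_mat[of _ q q _ q])
  moreover have "(l_lyap q a)\<^sup>T = (- adi_gamma a) \<cdot>\<^sub>m 1\<^sub>m q" using True by (auto simp: l_lyap_def)
  then have "(l_lyap q a)\<^sup>T * y = (- adi_gamma a) \<cdot>\<^sub>m y"
    using y by (simp add: mult_smult_assoc_mat[of _ q q _ q])
  moreover have "u * s_radi q a \<in> carrier_mat q q" using True u by (simp add: s_radi_def)
  ultimately have "(- adi_gamma a) \<cdot>\<^sub>m y = 0\<^sub>m q q" using eq by simp
  then have e: "((- adi_gamma a) \<cdot>\<^sub>m y) $$ (i, j) = 0\<^sub>m q q $$ (i, j)" for i j by simp
  have "y $$ (i, j) = 0" if "i < q" "j < q" for i j using e[of i j] that y g by simp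
  then show ?thesis
    using True y by (intro eq_matI) (auto simp: l_radi_def)
next
  case False
  \<comment> \<open>Since gamma squared is \<open>- 2 * b\<close>, the lower left block of
    \<open>s_lyap\<close> is \<open>k\<close> and the upper right one is \<open>- k\<close> times
    the identity. Cancelling \<open>b\<close> shows that \<open>k\<close> is c * sqrt (1 + (b /
    c)^2), whose square is b^2 + c^2.\<close>
  define b c k where "b = Re a" and "c = Im a" and "k = 2 * b * (sqrt (1 + (b / c)\<^sup>2) / (2 * (b / c)))"
  have b: "b < 0" and c: "c \<noteq> 0" using a False by (simp_all add: b_def c_def)
  have "sqrt (1 + (b / c)\<^sup>2) ^ 2 = 1 + (b / c)\<^sup>2" by simp
  then have kk: "k * k = b * b + c * c"
    using b c by (simp add: k_def field_simps power2_eq_square)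
  have k: "k \<noteq> 0"
  proof
    assume "k = 0"
    with kk have "b * b + c * c = 0" by simp
    with b show False by (simp add: sum_squares_eq_zero_iff)
  qed
  define g where "g = - (sqrt 2 * adi_gamma a)"
  have g: "g \<noteq> 0" using a by (simp add: g_def adi_gamma_def)
  have gg: "(adi_gamma a)\<^sup>2 = - 2 * b" using b by (simp add: adi_gamma_def b_def)
  from False y u have y: "y \<in> carrier_mat q (q + q)" and u: "u \<in> carrier_mat (q + q) (q + q)"
    by (auto simp: l_radi_def)
  obtain u1 u2 u3 u4 where "split_block u q q = (u1, u2, u3, u4)" by (metis prod_cases4)
  from split_block[OF this, of q q] u
  have uc: "u1 \<in> carrier_mat q q" "u2 \<in> carrier_mat q q" "u3 \<in> carrier_mat q q" "u4 \<in> carrier_mat q q"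
    and u_eq: "u = four_block_mat u1 u2 u3 u4" by auto
  obtain y1 y2 y3 y4 where "split_block y q q = (y1, y2, y3, y4)" by (metis prod_cases4)
  from split_block[OF this, of 0 q] y
  have yc: "y1 \<in> carrier_mat q q" "y2 \<in> carrier_mat q q" "y3 \<in> carrier_mat 0 q" "y4 \<in> carrier_mat 0 q"
    and y_eq: "y = four_block_mat y1 y2 y3 y4" by auto
  have "(l_lyap q a)\<^sup>T = four_block_mat (g \<cdot>\<^sub>m 1\<^sub>m q) (0\<^sub>m q 0) (0\<^sub>m q q) (0\<^sub>m q 0)"
    using False by (auto simp: l_lyap_def append_cols_def g_def)
  then have 1: "(l_lyap q a)\<^sup>T * y = four_block_mat (g \<cdot>\<^sub>m y1) (g \<cdot>\<^sub>m y2) (0\<^sub>m q q) (0\<^sub>m q q)"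
    using yc by (auto simp: y_eq mult_four_block_mat[of _ q q _ 0 _ q _ _ q _ q] mult_smult_assoc_mat[of _ q q _ q])
  have "s_lyap q a = four_block_mat ((- 2 * b) \<cdot>\<^sub>m 1\<^sub>m q) ((- k) \<cdot>\<^sub>m 1\<^sub>m q) (k \<cdot>\<^sub>m 1\<^sub>m q) (0\<^sub>m q q)"
    using False by (auto simp: s_lyap_def Let_def gg k_def adi_delta_def simp flip: b_def c_def)
  then have 2: "s_lyap q a * u = four_block_mat ((- 2 * b) \<cdot>\<^sub>m u1 + (- k) \<cdot>\<^sub>m u3)
      ((- 2 * b) \<cdot>\<^sub>m u2 + (- k) \<cdot>\<^sub>m u4) (k \<cdot>\<^sub>m u1) (k \<cdot>\<^sub>m u2)"
    using uc by (auto simp: u_eq mult_four_block_mat[of _ q q _ q _ q _ _ q _ q] mult_smult_assoc_mat[of _ q q _ q])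
  have 3: "u * s_radi q a = four_block_mat ((- b) \<cdot>\<^sub>m u1 + c \<cdot>\<^sub>m u2) ((- c) \<cdot>\<^sub>m u1 + (- b) \<cdot>\<^sub>m u2)
      ((- b) \<cdot>\<^sub>m u3 + c \<cdot>\<^sub>m u4) ((- c) \<cdot>\<^sub>m u3 + (- b) \<cdot>\<^sub>m u4)"
    using uc False by (auto simp: u_eq s_radi_def b_def c_def mult_four_block_mat[of _ q q _ q _ q _ _ q _ q]
        mult_smult_distrib[of _ q q _ q])
  have e: "((l_lyap q a)\<^sup>T * y) $$ (i, j) = (s_lyap q a * u - u * s_radi q a) $$ (i, j)" for i j
    using eq by simp
  have ent: "g * y1 $$ (i, j) = 0 \<and> g * y2 $$ (i, j) = 0" if "i < q" "j < q" for i j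
  proof -
    have e1: "g * y1 $$ (i, j) = - 2 * b * u1 $$ (i, j) - k * u3 $$ (i, j) - (c * u2 $$ (i, j) - b * u1 $$ (i, j))"
      using that uc yc e[of i j] unfolding 1 2 3 by auto
    have e2: "g * y2 $$ (i, j) = - 2 * b * u2 $$ (i, j) - k * u4 $$ (i, j) - (- c * u1 $$ (i, j) - b * u2 $$ (i, j))"
      using that uc yc e[of i "q + j"] unfolding 1 2 3 by auto
    have e3: "k * u1 $$ (i, j) = c * u4 $$ (i, j) - b * u3 $$ (i, j)"
      using that uc yc e[of "q + i" j] unfolding 1 2 3 by auto
    have e4: "k * u2 $$ (i, j) = - c * u3 $$ (i, j) - b * u4 $$ (i, j)"
      using that uc yc e[of "q + i" "q + j"] unfolding 1 2 3 by auto
    \<comment> \<open>Multiplying by the nonzero \<open>k\<close> makes \<open>k * u1\<close> and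
      \<open>k * u2\<close> appear, so that \<open>e3\<close> and \<open>e4\<close> apply without
      division.\<close>
    have "k * (g * y1 $$ (i, j)) = - b * (k * u1 $$ (i, j)) - (k * k) * u3 $$ (i, j) - c * (k * u2 $$ (i, j))"
      unfolding e1 by (simp add: algebra_simps)
    also have "\<dots> = 0" unfolding e3 e4 kk by (simp add: algebra_simps)
    finally have "k * (g * y1 $$ (i, j)) = 0" .
    moreover have "k * (g * y2 $$ (i, j)) = - b * (k * u2 $$ (i, j)) - (k * k) * u4 $$ (i, j) + c * (k * u1 $$ (i, j))"
      unfolding e2 by (simp add: algebra_simps)
    then have "k * (g * y2 $$ (i, j)) = 0" unfolding e3 e4 kk by (simp add: algebra_simps)
    ultimately show ?thesis using k by simp
  qed
  show ?thesis
    using False g ent yc by (intro eq_matI) (auto simp: y_eq l_radi_def)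
qed

section \<open>One step of the two iterations\<close>

text \<open>The last block row of S^T is [l^T L0, s^T]. Replacing s^T by l^T l - s turns its product
  with \<open>t\<close> into l^T (L0 t1 + l t2) - s t2, that is l^T L t - s t2. Every term that
  starts with \<open>T\<close> disappears, since \<open>T\<close> is zero in these rows.\<close>

lemma last_block_row:
  fixes L0 :: "'a :: comm_ring_1 mat"
  assumes car: "L0 \<in> carrier_mat q k" "l \<in> carrier_mat q d" "S0 \<in> carrier_mat k k" "s \<in> carrier_mat d d"
      "t1 \<in> carrier_mat k d" "t2 \<in> carrier_mat d d" "sw \<in> carrier_mat d d" "lw \<in> carrier_mat q d"
      "T0 \<in> carrier_mat k r" "F \<in> carrier_mat q (k + d)" "P \<in> carrier_mat r (k + d)" "Q \<in> carrier_mat r q"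
      "G \<in> carrier_mat q q"
    and s: "s + s\<^sup>T = l\<^sup>T * l"
    and defs: "S = four_block_mat S0 (L0\<^sup>T * l) (0\<^sub>m d k) s" "L = L0 @\<^sub>c l" "t = t1 @\<^sub>r t2" "T = T0 @\<^sub>r 0\<^sub>m d r"
    and eq: "(- S\<^sup>T + L\<^sup>T * F - T * P) * t - t * sw + (L\<^sup>T - T * Q) * G * lw = 0\<^sub>m (k + d) d"
  shows "l\<^sup>T * (L * t - (F * t + G * lw)) = s * t2 - t2 * sw"
proof -
  note [simp] = car[THEN carrier_matD(1)] car[THEN carrier_matD(2)]
  note [simp del] = assoc_mult_mat index_mult_mat(1)
  have tc: "t \<in> carrier_mat (k + d) d" and "T \<in> carrier_mat (k + d) r" "L \<in> carrier_mat q (k + d)"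
    "S \<in> carrier_mat (k + d) (k + d)"
    using car by (auto simp: defs)
  then have [simp]: "dim_row t = k + d" "dim_col t = d" "dim_row T = k + d" "dim_col T = r"
    "dim_row L = q" "dim_col L = k + d" "dim_row S = k + d" "dim_col S = k + d" by auto
  \<comment> \<open>Multiplication by \<open>J\<close> from the left selects the last
    \<open>d\<close> rows.\<close>
  define J :: "'a mat" where "J = 0\<^sub>m d k @\<^sub>c 1\<^sub>m d"
  have Jc: "J \<in> carrier_mat d (k + d)" by (simp add: J_def)
  then have [simp]: "dim_row J = d" "dim_col J = k + d" by auto
  have Jrows: "J * (P @\<^sub>r R) = R" if "P \<in> carrier_mat k c" "R \<in> carrier_mat d c" for P R c
    using that unfolding J_def by (subst append_cols_mult_append_rows[of _ d k _ d _ c]) auto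
  have Jt: "J * t = t2" unfolding defs by (rule Jrows) (use car in auto)
  have JT: "J * T = 0\<^sub>m d r" unfolding defs by (rule Jrows) (use car in auto)
  have JL: "J * L\<^sup>T = l\<^sup>T"
    unfolding defs by (subst transpose_append_cols) (use car in \<open>auto intro!: Jrows\<close>)
  have "S\<^sup>T = four_block_mat S0\<^sup>T (0\<^sub>m k d) (L0\<^sup>T * l)\<^sup>T s\<^sup>T"
    unfolding defs using car by (subst transpose_four_block_mat[of _ k k _ d _ d]) auto
  then have "J * S\<^sup>T = (L0\<^sup>T * l)\<^sup>T @\<^sub>c s\<^sup>T"
    unfolding J_def using car by (simp add: append_cols_mult_four_block[of _ d k _ d _ k _ d])
  then have "J * S\<^sup>T * t = (L0\<^sup>T * l)\<^sup>T * t1 + s\<^sup>T * t2"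
    using car by (simp add: defs append_cols_mult_append_rows[of _ d k _ d _ d])
  then have JSt: "J * (S\<^sup>T * t) = l\<^sup>T * (L0 * t1) + s\<^sup>T * t2" by (simp add: mat_normalize)
  have Lt: "L * t = L0 * t1 + l * t2"
    using car by (simp add: defs append_cols_mult_append_rows[of _ q k _ d _ d])
  have Jt': "J * (t * R) = t2 * R" if "dim_row R = d" for R using that by (simp add: Jt flip: mat_assoc_dim)
  have JT': "J * (T * R) = 0\<^sub>m d (dim_col R)" if "dim_row R = r" for R
    using that by (simp add: JT flip: mat_assoc_dim)
  have JL': "J * (L\<^sup>T * R) = l\<^sup>T * R" if "dim_row R = q" for R using that by (simp add: JL flip: mat_assoc_dim)
  have 1: "J * ((- S\<^sup>T + L\<^sup>T * F - T * P) * t - t * sw + (L\<^sup>T - T * Q) * G * lw) = 0\<^sub>m d d"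
    unfolding eq by simp
  have 2: "(s + s\<^sup>T) * t2 = l\<^sup>T * l * t2" unfolding s ..
  show ?thesis
  proof (rule eq_matI)
    fix i j assume "i < dim_row (s * t2 - t2 * sw)" "j < dim_col (s * t2 - t2 * sw)"
    then have [simp]: "i < d" "j < d" by auto
    note sum = arg_cong2[of _ _ _ _ "(+)", OF 2[THEN arg_cong[of _ _ "\<lambda>M. M $$ (i, j)"]]
      1[THEN arg_cong[of _ _ "\<lambda>M. M $$ (i, j)"]]]
    show "(l\<^sup>T * (L * t - (F * t + G * lw))) $$ (i, j) = (s * t2 - t2 * sw) $$ (i, j)"
      using sum by (simp add: mat_normalize Lt Jt' JT' JL' JSt algebra_simps)
  qed simp_all
qed

text \<open>Transposition exchanges the two terms containing \<open>Y\<close> and fixes the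
  symmetric constant term. With uniqueness this makes the solution symmetric, hence also its inverse
  \<open>x i\<close>.\<close>

lemma lyapunov_solution_transpose:
  fixes Y :: "'a :: comm_ring_1 mat"
  assumes car: "Y \<in> carrier_mat d d" "s \<in> carrier_mat d d" "l \<in> carrier_mat q d" "Q \<in> carrier_mat q q"
      "w \<in> carrier_mat n d" "H \<in> carrier_mat n m" "G \<in> carrier_mat m m"
    and sym: "Q\<^sup>T = Q" "G\<^sup>T = G"
    and eq: "- s\<^sup>T * Y - Y * s + l\<^sup>T * Q * l + w\<^sup>T * H * G * H\<^sup>T * w = 0\<^sub>m d d"
  shows "- s\<^sup>T * Y\<^sup>T - Y\<^sup>T * s + l\<^sup>T * Q * l + w\<^sup>T * H * G * H\<^sup>T * w = 0\<^sub>m d d"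
proof -
  note [simp] = car[THEN carrier_matD(1)] car[THEN carrier_matD(2)] sym
  note [simp del] = assoc_mult_mat index_mult_mat(1)
  have 1: "(- s\<^sup>T * Y - Y * s + l\<^sup>T * Q * l + w\<^sup>T * H * G * H\<^sup>T * w)\<^sup>T = 0\<^sub>m d d"
    unfolding eq by simp
  show ?thesis
  proof (rule eq_matI)
    fix i j assume "i < dim_row (0\<^sub>m d d :: 'a mat)" "j < dim_col (0\<^sub>m d d :: 'a mat)"
    then have "i < d" "j < d" by auto
    then show "(- s\<^sup>T * Y\<^sup>T - Y\<^sup>T * s + l\<^sup>T * Q * l + w\<^sup>T * H * G * H\<^sup>T * w) $$ (i, j) = (0\<^sub>m d d :: 'a mat) $$ (i, j)"
      using 1[THEN arg_cong[of _ _ "\<lambda>M. M $$ (i, j)"]]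
      by (simp add: mat_normalize algebra_simps del: transpose_mult)
  qed simp_all
qed

text \<open>Gives the real and the paired update one common form, from which the closed form of the
  residual follows by summation. For a pair, \<open>l_lyap\<close> is zero on its last q columns, so
  only the first half of \<open>z\<close> enters, and the two factors sqrt 2 * gamma multiply to 2
  gamma^2.\<close>

lemma lyap_residual_step:
  fixes E C C' z :: "real mat" and v :: "complex mat"
  assumes car: "E \<in> carrier_mat n n" "C \<in> carrier_mat q n" "v \<in> carrier_mat n q"
    and re: "Im a = 0 \<Longrightarrow> cmat z = complex_of_real (adi_gamma a) \<cdot>\<^sub>m v \<and>
        cmat C' = cmat C + complex_of_real ((adi_gamma a)^2) \<cdot>\<^sub>m (v\<^sup>T * cmat E)"
    and im: "Im a \<noteq> 0 \<Longrightarrow>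
        z = ((sqrt 2 * adi_gamma a) \<cdot>\<^sub>m (Re_mat v + adi_delta a \<cdot>\<^sub>m Im_mat v))
              @\<^sub>c ((sqrt 2 * adi_gamma a * sqrt ((adi_delta a)^2 + 1)) \<cdot>\<^sub>m Im_mat v) \<and>
        C' = C + (2 * (adi_gamma a)^2) \<cdot>\<^sub>m ((Re_mat v + adi_delta a \<cdot>\<^sub>m Im_mat v)\<^sup>T * E)"
  shows "z \<in> carrier_mat n (dim_col (l_lyap q a))" "C' = C - l_lyap q a * z\<^sup>T * E"
proof -
  have "z \<in> carrier_mat n (dim_col (l_lyap q a)) \<and> C' = C - l_lyap q a * z\<^sup>T * E"
  proof (cases "Im a = 0")
    case True
    define V where "V = Re_mat v"
    have V: "V \<in> carrier_mat n q" using car by (simp add: V_def)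
    \<comment> \<open>For a real shift the recursion is stated over the complex numbers; taking real
      parts of both equations brings it back to real matrices.\<close>
    have "Re_mat (cmat z) = Re_mat (complex_of_real (adi_gamma a) \<cdot>\<^sub>m v)" using re[OF True] by simp
    moreover have "Re_mat (cmat z) = z" by auto
    moreover have "Re_mat (complex_of_real (adi_gamma a) \<cdot>\<^sub>m v) = adi_gamma a \<cdot>\<^sub>m V" by (auto simp: V_def)
    ultimately have z: "z = adi_gamma a \<cdot>\<^sub>m V" by simp
    have "Re_mat (cmat C') = Re_mat (cmat C + complex_of_real ((adi_gamma a)^2) \<cdot>\<^sub>m (v\<^sup>T * cmat E))"
      using re[OF True] by simp
    moreover have "Re_mat (cmat C') = C'" by auto
    moreover have "Re_mat (cmat C + complex_of_real ((adi_gamma a)^2) \<cdot>\<^sub>m (v\<^sup>T * cmat E))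
        = C + ((adi_gamma a)^2) \<cdot>\<^sub>m (V\<^sup>T * E)"
      using car by (intro eq_matI) (auto simp: V_def scalar_prod_def simp flip: of_real_power)
    ultimately have C': "C' = C + ((adi_gamma a)^2) \<cdot>\<^sub>m (V\<^sup>T * E)" by simp
    have "l_lyap q a * z\<^sup>T * E = ((- adi_gamma a) \<cdot>\<^sub>m 1\<^sub>m q) * (adi_gamma a \<cdot>\<^sub>m V\<^sup>T) * E"
      using True by (simp add: l_lyap_def z transpose_smult)
    also have "\<dots> = (- adi_gamma a * adi_gamma a) \<cdot>\<^sub>m (V\<^sup>T * E)"
      using V car(1) by (auto simp: mult_smult_assoc_mat[of _ q q _ n] mult_smult_assoc_mat[of _ q n _ n])
    finally show ?thesis
      using V car True C' by (auto simp: z l_lyap_def power2_eq_square)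
  next
    case False
    define Y where "Y = Re_mat v + adi_delta a \<cdot>\<^sub>m Im_mat v"
    define Y' where "Y' = (sqrt 2 * adi_gamma a * sqrt ((adi_delta a)^2 + 1)) \<cdot>\<^sub>m Im_mat v"
    have Y: "Y \<in> carrier_mat n q" "Y' \<in> carrier_mat n q" using car by (auto simp: Y_def Y'_def)
    from im[OF False] have z: "z = ((sqrt 2 * adi_gamma a) \<cdot>\<^sub>m Y) @\<^sub>c Y'"
      and C': "C' = C + (2 * (adi_gamma a)^2) \<cdot>\<^sub>m (Y\<^sup>T * E)" by (simp_all add: Y_def Y'_def)
    define g where "g = sqrt 2 * adi_gamma a"
    have gg: "g * g = 2 * (adi_gamma a)^2" by (simp add: g_def power2_eq_square)
    have "l_lyap q a = ((- g) \<cdot>\<^sub>m 1\<^sub>m q) @\<^sub>c 0\<^sub>m q q"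
      using False by (auto simp: l_lyap_def g_def)
    then have "l_lyap q a * z\<^sup>T = (- g * g) \<cdot>\<^sub>m Y\<^sup>T"
      using Y unfolding z g_def[symmetric]
      by (auto simp: append_cols_mult_transpose[of _ q q _ q _ n] transpose_smult
          mult_smult_assoc_mat[of _ q q _ n])
    then have "l_lyap q a * z\<^sup>T * E = (- g * g) \<cdot>\<^sub>m (Y\<^sup>T * E)"
      using Y car(1) by (simp add: mult_smult_assoc_mat[of _ q n _ n])
    then show ?thesis
      using Y car False C' gg by (auto simp: z l_lyap_def)
  qed
  then show "z \<in> carrier_mat n (dim_col (l_lyap q a))" "C' = C - l_lyap q a * z\<^sup>T * E" by auto
qed

section \<open>Induction over the shift blocks\<close>

theorem theorem2p3:
  fixes n m1 m2 p q N :: nat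
    and E A B1 B2 C1 C2 R1 R2 Z :: "real mat"
    and Bt Bh Rh Ch Zh Ah :: "real mat"
    and \<alpha> :: "nat \<Rightarrow> complex"
    and w x W X Lw Cp Br Cr :: "nat \<Rightarrow> real mat"
    and v :: "nat \<Rightarrow> complex mat"
    and z Cl Sl Ll Zl Bbl Bhl :: "nat \<Rightarrow> real mat"
    and t :: "nat \<Rightarrow> complex mat"
    and tr t1 t2 T :: "nat \<Rightarrow> real mat"
  assumes data:
      "E \<in> carrier_mat n n" "A \<in> carrier_mat n n"
      "B1 \<in> carrier_mat n m1" "B2 \<in> carrier_mat n m2"
      "C1 \<in> carrier_mat p n" "C2 \<in> carrier_mat m1 n"
      "R1 \<in> carrier_mat m1 m1" "R1\<^sup>T = R1" "invertible_mat R1"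
      "R2 \<in> carrier_mat m2 m2" "R2\<^sup>T = R2" "invertible_mat R2"
      "Z \<in> carrier_mat p p" "Z\<^sup>T = Z"
    and derived:
      "q = p + m1"
      "Bt = 0\<^sub>m n p @\<^sub>c B1"
      "Bh = B1 @\<^sub>c B2"
      "Rh = diag_block_mat [R1, - R2]"
      "Ch = C1 @\<^sub>r C2"
      "Zh = diag_block_mat [Z, - inv_mat R1]"
      "Ah = A + Bt * Zh * Ch"
    and shifts: "\<forall>i\<in>{1..N}. Re (\<alpha> i) < 0"
    \<comment> \<open>Riccati-ADI\<close>
    and radi_0: "W 0 = 0\<^sub>m n 0" "X 0 = 0\<^sub>m 0 0" "Lw 0 = 0\<^sub>m q 0" "Cp 0 = Ch"
    and radi_w: "\<forall>i\<in>{1..N}. w i \<in> carrier_mat n (dim_col (l_radi q (\<alpha> i))) \<and>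
      (Ah - Bh * inv_mat Rh * Bh\<^sup>T * W (i - 1) * X (i - 1) * (W (i - 1))\<^sup>T * E)\<^sup>T * w i
        - E\<^sup>T * w i * s_radi q (\<alpha> i) + (Cp (i - 1))\<^sup>T * Zh * l_radi q (\<alpha> i)
        = 0\<^sub>m n (dim_col (l_radi q (\<alpha> i)))"
    and radi_w_unique: "\<forall>i\<in>{1..N}. \<forall>w' \<in> carrier_mat n (dim_col (l_radi q (\<alpha> i))).
      (Ah - Bh * inv_mat Rh * Bh\<^sup>T * W (i - 1) * X (i - 1) * (W (i - 1))\<^sup>T * E)\<^sup>T * w'
        - E\<^sup>T * w' * s_radi q (\<alpha> i) + (Cp (i - 1))\<^sup>T * Zh * l_radi q (\<alpha> i)
        = 0\<^sub>m n (dim_col (l_radi q (\<alpha> i)))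
      \<longrightarrow> w' = w i"
    and radi_x: "\<forall>i\<in>{1..N}. \<exists>Y.
      (let k = dim_col (l_radi q (\<alpha> i));
           sol = (\<lambda>Y'. Y' \<in> carrier_mat k k \<and>
             - (s_radi q (\<alpha> i))\<^sup>T * Y' - Y' * s_radi q (\<alpha> i)
               + (l_radi q (\<alpha> i))\<^sup>T * Zh * l_radi q (\<alpha> i)
               + (w i)\<^sup>T * Bh * inv_mat Rh * Bh\<^sup>T * w i = 0\<^sub>m k k)
       in sol Y \<and> (\<forall>Y'. sol Y' \<longrightarrow> Y' = Y)) \<and> invertible_mat Y \<and> x i = inv_mat Y"
    and radi_step: "\<forall>i\<in>{1..N}.
        Lw i = Lw (i - 1) @\<^sub>c l_radi q (\<alpha> i) \<and>
        W i = W (i - 1) @\<^sub>c w i \<and>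
        X i = diag_block_mat [X (i - 1), x i] \<and>
        Cp i = Ch - Lw i * X i * (W i)\<^sup>T * E"
    and radi_red: "\<forall>i\<in>{0..N}. Br i = (W i)\<^sup>T * Bh \<and> Cr i = Lw i * X i"
    \<comment> \<open>Lyapunov-ADI\<close>
    and lyap_0: "Cl 0 = Ch" "Sl 0 = 0\<^sub>m 0 0" "Ll 0 = 0\<^sub>m q 0" "Zl 0 = 0\<^sub>m n 0"
    and lyap_v: "\<forall>i\<in>{1..N}.
        invertible_mat (cmat (A\<^sup>T) + \<alpha> i \<cdot>\<^sub>m cmat (E\<^sup>T)) \<and>
        v i = inv_mat (cmat (A\<^sup>T) + \<alpha> i \<cdot>\<^sub>m cmat (E\<^sup>T)) * cmat ((Cl (i - 1))\<^sup>T)"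
    and lyap_real: "\<forall>i\<in>{1..N}. Im (\<alpha> i) = 0 \<longrightarrow>
        cmat (z i) = complex_of_real (adi_gamma (\<alpha> i)) \<cdot>\<^sub>m v i \<and>
        cmat (Cl i) = cmat (Cl (i - 1))
          + complex_of_real ((adi_gamma (\<alpha> i))^2) \<cdot>\<^sub>m ((v i)\<^sup>T * cmat E)"
    and lyap_pair: "\<forall>i\<in>{1..N}. Im (\<alpha> i) \<noteq> 0 \<longrightarrow>
        z i = ((sqrt 2 * adi_gamma (\<alpha> i)) \<cdot>\<^sub>m
                  (Re_mat (v i) + adi_delta (\<alpha> i) \<cdot>\<^sub>m Im_mat (v i)))
              @\<^sub>c ((sqrt 2 * adi_gamma (\<alpha> i) * sqrt ((adi_delta (\<alpha> i))^2 + 1)) \<cdot>\<^sub>m Im_mat (v i)) \<and>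
        Cl i = Cl (i - 1)
          + (2 * (adi_gamma (\<alpha> i))^2) \<cdot>\<^sub>m
              ((Re_mat (v i) + adi_delta (\<alpha> i) \<cdot>\<^sub>m Im_mat (v i))\<^sup>T * E)"
    and lyap_step: "\<forall>i\<in>{1..N}.
        Sl i = four_block_mat
                 (Sl (i - 1))                                    ((Ll (i - 1))\<^sup>T * l_lyap q (\<alpha> i))
                 (0\<^sub>m (dim_row (s_lyap q (\<alpha> i))) (dim_col (Sl (i - 1)))) (s_lyap q (\<alpha> i)) \<and>
        Ll i = Ll (i - 1) @\<^sub>c l_lyap q (\<alpha> i) \<and>
        Zl i = Zl (i - 1) @\<^sub>c z i"
    and lyap_eqs: "\<forall>i\<in>{1..N}.
        A\<^sup>T * Zl i - E\<^sup>T * Zl i * Sl i + Ch\<^sup>T * Ll i = 0\<^sub>m n (dim_col (Zl i)) \<and>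
        A\<^sup>T * Zl i + E\<^sup>T * Zl i * (Sl i)\<^sup>T + (Cl i)\<^sup>T * Ll i = 0\<^sub>m n (dim_col (Zl i))"
    and lyap_red: "\<forall>i\<in>{1..N}. Bbl i = (Zl i)\<^sup>T * Bt \<and> Bhl i = (Zl i)\<^sup>T * Bh"
    \<comment> \<open>transformation\<close>
    and T_0: "T 0 = 0\<^sub>m 0 0"
    and t_def: "\<forall>i\<in>{1..N}.
      (let T0 = T (i - 1) @\<^sub>r 0\<^sub>m (dim_col (z i)) (dim_col (T (i - 1)));
           M = cmat (- (Sl i)\<^sup>T + (Ll i)\<^sup>T * Zh * (Bbl i)\<^sup>T
                     - T0 * X (i - 1) * Br (i - 1) * inv_mat Rh * (Bhl i)\<^sup>T)
               + \<alpha> i \<cdot>\<^sub>m 1\<^sub>m (dim_col (Zl i))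
       in invertible_mat M \<and>
          t i = inv_mat M * cmat (((Ll i)\<^sup>T - T0 * (Cr (i - 1))\<^sup>T) * Zh))"
    and tr_def: "\<forall>i\<in>{1..N}.
        (Im (\<alpha> i) = 0 \<longrightarrow> cmat (tr i) = t i) \<and>
        (Im (\<alpha> i) \<noteq> 0 \<longrightarrow> tr i = Re_mat (t i) @\<^sub>c Im_mat (t i))"
    and tr_split: "\<forall>i\<in>{1..N}.
        t1 i \<in> carrier_mat (dim_col (Zl (i - 1))) (dim_col (tr i)) \<and>
        t2 i \<in> carrier_mat (dim_col (z i)) (dim_col (tr i)) \<and>
        tr i = t1 i @\<^sub>r t2 i"
    and T_step: "\<forall>i\<in>{1..N}.
        T i = four_block_mat (T (i - 1))                              (t1 i)
                             (0\<^sub>m (dim_row (t2 i)) (dim_col (T (i - 1)))) (t2 i)"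
  shows "\<forall>i\<in>{1..N}. w i = Zl i * tr i \<and> W i = Zl i * T i"
proof -
  note E = data(1) and A = data(2)
  define m where "m = m1 + m2"
  define G where "G = inv_mat Rh"
  define d where "d i = dim_col (l_radi q (\<alpha> i))" for i
  define k where "k i = dim_col (Zl i)" for i
  note bc = block_carriers[of q "\<alpha> i" for i, folded d_def]
  have Bt: "Bt \<in> carrier_mat n q" using data derived(1,2) by auto
  have Bh: "Bh \<in> carrier_mat n m" using data derived(3) by (auto simp: m_def)
  have Ch: "Ch \<in> carrier_mat q n" using data derived(1,5) by auto
  have negR2: "- R2 \<in> carrier_mat m2 m2" "(- R2)\<^sup>T = - R2" "invertible_mat (- R2)"
    using data(10-12) invertible_mat_uminus[of R2 m2] by (auto simp: transpose_uminus)
  have Rh: "Rh \<in> carrier_mat m m" "Rh\<^sup>T = Rh" "invertible_mat Rh"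
    unfolding derived(4) m_def
    using diag_block_mat_two_sym[OF data(7,8) negR2(1,2)] invertible_diag_block_mat[OF data(7,9) negR2(1,3)]
    by blast+
  have G: "G \<in> carrier_mat m m" "G\<^sup>T = G"
    unfolding G_def using inv_mat_correct(1)[OF Rh(1,3)] inv_mat_sym[OF Rh(1,3,2)] by auto
  have "- inv_mat R1 \<in> carrier_mat m1 m1" "(- inv_mat R1)\<^sup>T = - inv_mat R1"
    using inv_mat_correct(1)[OF data(7,9)] inv_mat_sym[OF data(7,9,8)] by (auto simp: transpose_uminus)
  from diag_block_mat_two_sym[OF data(13,14) this]
  have Zh: "Zh \<in> carrier_mat q q" "Zh\<^sup>T = Zh" unfolding derived(1,6) by auto

  \<comment> \<open>Besides W = Zl T the induction carries the dimensions, with one common column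
    count \<open>k i\<close> for both bases, the symmetry of \<open>X i\<close> and the closed forms
    of both residuals.\<close>
  define invar where "invar i \<longleftrightarrow> W i \<in> carrier_mat n (k i) \<and> X i \<in> carrier_mat (k i) (k i) \<and> (X i)\<^sup>T = X i
      \<and> Lw i \<in> carrier_mat q (k i) \<and> Cp i = Ch - Lw i * X i * (W i)\<^sup>T * E
      \<and> Zl i \<in> carrier_mat n (k i) \<and> Sl i \<in> carrier_mat (k i) (k i) \<and> Ll i \<in> carrier_mat q (k i)
      \<and> Cl i = Ch - Ll i * (Zl i)\<^sup>T * E \<and> T i \<in> carrier_mat (k i) (k i) \<and> W i = Zl i * T i" for i
  have invar0: "invar 0"
  proof -
    \<comment> \<open>At index 0 the products of q-by-0 and 0-by-n matrices are zero matrices, so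
      both closed forms reduce to \<open>Ch\<close>.\<close>
    have "Ch - 0\<^sub>m q n * E = Ch" using Ch E by auto
    then show ?thesis
      unfolding invar_def by (auto simp: k_def radi_0 lyap_0 T_0)
  qed
  have step: "invar i \<and> w i = Zl i * tr i" if i: "i \<in> {1..N}" and IH: "invar (i - 1)" for i
  proof -
    define i' where "i' = i - 1"
    define K where "K = k i'"
    note IH' = IH[unfolded invar_def, folded i'_def, folded K_def]
    have W0: "W i' \<in> carrier_mat n K" and X0: "X i' \<in> carrier_mat K K" "(X i')\<^sup>T = X i'"
      and Lw0: "Lw i' \<in> carrier_mat q K" and Cp0: "Cp i' = Ch - Lw i' * X i' * (W i')\<^sup>T * E"
      and Zl0: "Zl i' \<in> carrier_mat n K" and Sl0: "Sl i' \<in> carrier_mat K K" and Ll0: "Ll i' \<in> carrier_mat q K"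
      and Cl0: "Cl i' = Ch - Ll i' * (Zl i')\<^sup>T * E" and T0: "T i' \<in> carrier_mat K K"
      and WT0: "W i' = Zl i' * T i'"
      using IH' by auto
    have Cl0c: "Cl i' \<in> carrier_mat q n" unfolding Cl0 using Ch Ll0 Zl0 E by auto
    have a: "Re (\<alpha> i) < 0" using shifts i by auto
    note steps = radi_step[rule_format, OF i, folded i'_def] lyap_step[rule_format, OF i, folded i'_def]
    have w: "w i \<in> carrier_mat n (d i)" using radi_w i by (auto simp: d_def)

    have x: "x i \<in> carrier_mat (d i) (d i)" "(x i)\<^sup>T = x i"
    proof -
      from radi_x[rule_format, OF i, folded d_def] obtain Y where
        Y: "Y \<in> carrier_mat (d i) (d i)" "invertible_mat Y" "x i = inv_mat Y"
        and eq: "- (s_radi q (\<alpha> i))\<^sup>T * Y - Y * s_radi q (\<alpha> i)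
               + (l_radi q (\<alpha> i))\<^sup>T * Zh * l_radi q (\<alpha> i)
               + (w i)\<^sup>T * Bh * inv_mat Rh * Bh\<^sup>T * w i = 0\<^sub>m (d i) (d i)"
        and uniq: "\<And>Y'. Y' \<in> carrier_mat (d i) (d i) \<Longrightarrow> - (s_radi q (\<alpha> i))\<^sup>T * Y' - Y' * s_radi q (\<alpha> i)
               + (l_radi q (\<alpha> i))\<^sup>T * Zh * l_radi q (\<alpha> i)
               + (w i)\<^sup>T * Bh * inv_mat Rh * Bh\<^sup>T * w i = 0\<^sub>m (d i) (d i) \<Longrightarrow> Y' = Y"
        unfolding Let_def by blast
      have "Y\<^sup>T = Y"
        by (rule uniq[OF _ lyapunov_solution_transpose[OF Y(1) bc(3,2) Zh(1) w Bh G(1)[unfolded G_def]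
                Zh(2) G(2)[unfolded G_def] eq]]) (use Y in auto)
      then show "x i \<in> carrier_mat (d i) (d i)" "(x i)\<^sup>T = x i"
        using inv_mat_correct(1)[OF Y(1,2)] inv_mat_sym[OF Y(1,2)] Y(3) by auto
    qed

    have "cmat (A\<^sup>T) + \<alpha> i \<cdot>\<^sub>m cmat (E\<^sup>T) \<in> carrier_mat n n" "cmat ((Cl i')\<^sup>T) \<in> carrier_mat n q"
      using A E Cl0c by auto
    then have v: "v i \<in> carrier_mat n q"
      using lyap_v[rule_format, OF i, folded i'_def] inv_mat_mult_solves(1) by blast
    have z: "z i \<in> carrier_mat n (d i)" and Cl: "Cl i = Cl i' - l_lyap q (\<alpha> i) * (z i)\<^sup>T * E"
      using lyap_residual_step[OF E Cl0c v lyap_real[rule_format, OF i, folded i'_def]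
        lyap_pair[rule_format, OF i, folded i'_def]] carrier_matD(2)[OF bc(4)[of i]] by simp_all
    have ki: "k i = K + d i" using steps Zl0 z by (simp add: k_def)
    have Zl: "Zl i \<in> carrier_mat n (k i)" and Ll: "Ll i \<in> carrier_mat q (k i)"
      and Sl: "Sl i \<in> carrier_mat (k i) (k i)" and W: "W i \<in> carrier_mat n (k i)"
      and Lw: "Lw i \<in> carrier_mat q (k i)" and X: "X i \<in> carrier_mat (k i) (k i)"
      unfolding ki using steps Zl0 z Ll0 bc(2-5)[of i] Sl0 W0 w Lw0 X0 x diag_block_mat_two_sym(1)[of "X i'" K "x i" "d i"]
      by auto
    have Xs: "(X i)\<^sup>T = X i" using steps diag_block_mat_two_sym(2)[OF X0 x] by auto
    have "Ll i * (Zl i)\<^sup>T = Ll i' * (Zl i')\<^sup>T + l_lyap q (\<alpha> i) * (z i)\<^sup>T"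
      using steps append_cols_mult_transpose[OF Ll0 bc(4) Zl0 z] by simp
    moreover have "l_lyap q (\<alpha> i) * (z i)\<^sup>T \<in> carrier_mat q n" "Ll i' * (Zl i')\<^sup>T \<in> carrier_mat q n"
      using bc(4)[of i] z Ll0 Zl0 by auto
    moreover have "Ch - P * E - Q * E = Ch - (P + Q) * E"
      if "P \<in> carrier_mat q n" "Q \<in> carrier_mat q n" for P Q
      using that Ch E by (intro eq_matI) (auto simp: add_mult_distrib_mat[of _ q n] simp del: index_mult_mat(1))
    ultimately have Cli: "Cl i = Ch - Ll i * (Zl i)\<^sup>T * E"
      unfolding Cl Cl0 by metis

    \<comment> \<open>The zero rows stand opposite the new columns \<open>z i\<close>, so
      \<open>Zl i * T0'\<close> is still the previous Riccati basis.\<close>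
    define T0' where "T0' = T i' @\<^sub>r 0\<^sub>m (d i) K"
    define M where "M = - (Sl i)\<^sup>T + (Ll i)\<^sup>T * Zh * (Bbl i)\<^sup>T - T0' * X i' * Br i' * G * (Bhl i)\<^sup>T"
    define R where "R = ((Ll i)\<^sup>T - T0' * (Cr i')\<^sup>T) * Zh"
    have T0': "T0' \<in> carrier_mat (k i) K" unfolding T0'_def ki using T0 by auto
    have Bbl: "Bbl i = (Zl i)\<^sup>T * Bt" "Bhl i = (Zl i)\<^sup>T * Bh" using lyap_red i by auto
    have Br: "Br i' = (W i')\<^sup>T * Bh" "Cr i' = Lw i' * X i'" using radi_red i by (auto simp: i'_def)
    have Mc: "M \<in> carrier_mat (k i) (k i)" unfolding M_def Bbl Br using Sl Ll Zh Bt Zl T0' X0 W0 Bh G by auto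
    have Rc: "R \<in> carrier_mat (k i) q" unfolding R_def Br using Ll T0' Lw0 X0 Zh by auto
    have dims: "dim_col (z i) = d i" "dim_col (T i') = K" "dim_col (Zl i) = k i" "dim_col (Zl i') = K"
      using z T0 Zl Zl0 by auto
    have M': "invertible_mat (cmat M + \<alpha> i \<cdot>\<^sub>m 1\<^sub>m (k i))" "t i = inv_mat (cmat M + \<alpha> i \<cdot>\<^sub>m 1\<^sub>m (k i)) * cmat R"
      using t_def[rule_format, OF i, folded i'_def G_def, unfolded dims, folded T0'_def, unfolded Let_def, folded M_def R_def]
      by auto
    have t: "t i \<in> carrier_mat (k i) q" "(cmat M + \<alpha> i \<cdot>\<^sub>m 1\<^sub>m (k i)) * t i = cmat R"
      using inv_mat_mult_solves[OF _ M'(1) _ M'(2), of "k i" q] Mc Rc by simp_all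
    have tr: "tr i \<in> carrier_mat (k i) (d i)"
      and teq: "M * tr i - tr i * s_radi q (\<alpha> i) + R * l_radi q (\<alpha> i) = 0\<^sub>m (k i) (d i)"
      using shifted_system_real_form[OF Mc Rc t, of "tr i"] tr_def[rule_format, OF i] by (auto simp: d_def)
    have t12: "t1 i \<in> carrier_mat K (d i)" "t2 i \<in> carrier_mat (d i) (d i)" "tr i = t1 i @\<^sub>r t2 i"
      using tr_split[rule_format, OF i, folded i'_def, unfolded dims] tr by auto

    have Zt: "Zl i * T0' = W i'" unfolding WT0 T0'_def
      using steps append_cols_mult_append_rows[OF Zl0 z T0, of "0\<^sub>m (d i) K"] Zl0 z T0 by auto

    \<comment> \<open>\<open>F\<close> and \<open>P\<close> are what follows L^T and the padded
      \<open>T0'\<close> in the coefficient matrix of the system, regrouped to the shape of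
      \<open>last_block_row\<close>.\<close>
    define F where "F = Zh * Bt\<^sup>T * Zl i"
    define P where "P = X i' * (W i')\<^sup>T * Bh * G * Bh\<^sup>T * Zl i"
    have Fc: "F \<in> carrier_mat q (K + d i)" and Pc: "P \<in> carrier_mat K (K + d i)"
      unfolding F_def P_def using Zh Bt Zl X0 W0 Bh G by (auto simp: ki)
    note car = Zh(1) Bt Zl X0(1) W0 Bh G(1) T0' Ll Sl
    note [simp] = car[THEN carrier_matD(1)] car[THEN carrier_matD(2)]
    have M_eq: "M = - (Sl i)\<^sup>T + (Ll i)\<^sup>T * F - T0' * P"
      unfolding M_def F_def P_def Bbl Br by (simp add: mat_normalize del: assoc_mult_mat)
    have Q: "(Lw i' * X i')\<^sup>T \<in> carrier_mat K q" using Lw0 X0 by auto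
    have "(l_lyap q (\<alpha> i))\<^sup>T * (Ll i * tr i - (F * tr i + Zh * l_radi q (\<alpha> i)))
        = s_lyap q (\<alpha> i) * t2 i - t2 i * s_radi q (\<alpha> i)"
    proof (rule last_block_row[OF Ll0 bc(4) Sl0 bc(5) t12(1,2) bc(3,2) T0 Fc Pc Q Zh(1) lyap_block_sum[OF a]])
      show "Sl i = four_block_mat (Sl i') ((Ll i')\<^sup>T * l_lyap q (\<alpha> i)) (0\<^sub>m (d i) K) (s_lyap q (\<alpha> i))"
        using steps bc(5)[of i] Sl0 by auto
      show "(- (Sl i)\<^sup>T + (Ll i)\<^sup>T * F - T0' * P) * tr i - tr i * s_radi q (\<alpha> i)
          + ((Ll i)\<^sup>T - T0' * (Lw i' * X i')\<^sup>T) * Zh * l_radi q (\<alpha> i) = 0\<^sub>m (K + d i) (d i)"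
        using teq unfolding M_eq R_def Br ki by simp
      show "Ll i = Ll i' @\<^sub>c l_lyap q (\<alpha> i)" using steps by blast
      show "tr i = t1 i @\<^sub>r t2 i" by (rule t12(3))
      show "T0' = T i' @\<^sub>r 0\<^sub>m (d i) K" by (rule T0'_def)
    qed
    moreover have "Ll i * tr i - (F * tr i + Zh * l_radi q (\<alpha> i)) \<in> carrier_mat q (d i)"
      by (intro carrier_matI) (use carrier_matD(2)[OF bc(2)[of i]] in simp_all)
    \<comment> \<open>\<open>t2 i\<close> serves as the unknown \<open>u\<close> of
      \<open>block_kernel\<close>; the conclusion concerns only the residual factor.\<close>
    ultimately have y: "Ll i * tr i - (F * tr i + Zh * l_radi q (\<alpha> i)) = 0\<^sub>m q (d i)"
      using block_kernel[OF a, of _ q "t2 i", folded d_def] t12(2) by blast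
    have res: "Ll i * tr i = Zh * Bt\<^sup>T * Zl i * tr i + Zh * l_radi q (\<alpha> i)"
    proof (rule eq_matI)
      fix a b assume "a < dim_row (Zh * Bt\<^sup>T * Zl i * tr i + Zh * l_radi q (\<alpha> i))"
        "b < dim_col (Zh * Bt\<^sup>T * Zl i * tr i + Zh * l_radi q (\<alpha> i))"
      then show "(Ll i * tr i) $$ (a, b) = (Zh * Bt\<^sup>T * Zl i * tr i + Zh * l_radi q (\<alpha> i)) $$ (a, b)"
        using y[THEN arg_cong[of _ _ "\<lambda>M. M $$ (a, b)"]] bc(2)[of i] tr
        unfolding F_def by (simp del: index_mult_mat(1) assoc_mult_mat)
    qed (use bc(2)[of i] tr in auto)

    have lyap: "A\<^sup>T * Zl i + E\<^sup>T * Zl i * (Sl i)\<^sup>T + (Ch - Ll i * (Zl i)\<^sup>T * E)\<^sup>T * Ll i = 0\<^sub>m n (k i)"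
      using lyap_eqs[rule_format, OF i] unfolding Cli k_def by blast
    have "(A + Bt * Zh * Ch - Bh * G * Bh\<^sup>T * W i' * X i' * (W i')\<^sup>T * E)\<^sup>T * (Zl i * tr i)
      - E\<^sup>T * (Zl i * tr i) * s_radi q (\<alpha> i) + (Ch - Lw i' * X i' * (W i')\<^sup>T * E)\<^sup>T * Zh * l_radi q (\<alpha> i)
      = 0\<^sub>m n (d i)"
      using teq[unfolded M_def R_def Bbl Br]
      by (intro riccati_adi_from_lyapunov[OF E A Bt Bh G(1) Ch Zh(1) W0 X0(1) Lw0 Zl Sl Ll T0' tr bc(3,2)
            G(2) Zh(2) X0(2) Zt lyap _ res]) simp
    then have w_eq: "w i = Zl i * tr i"
      using radi_w_unique[rule_format, OF i, of "Zl i * tr i", folded i'_def G_def d_def] Zl tr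
      unfolding Cp0 derived(7) by simp

    have T: "T i = four_block_mat (T i') (t1 i) (0\<^sub>m (d i) K) (t2 i)"
      using T_step[rule_format, OF i, folded i'_def] t12(2) dims by simp
    then have Tc: "T i \<in> carrier_mat (k i) (k i)" using T0 t12 by (auto simp: ki)
    \<comment> \<open>The left block column of \<open>T i\<close> is \<open>T0'\<close> and the
      right one is \<open>tr i\<close>, so the product consists of the previous \<open>W i'\<close>
      followed by \<open>w i\<close>.\<close>
    have "Zl i * T i = (Zl i' * T i' + z i * 0\<^sub>m (d i) K) @\<^sub>c (Zl i' * t1 i + z i * t2 i)"
      using steps append_cols_mult_four_block[OF Zl0 z T0 t12(1) _ t12(2), of "0\<^sub>m (d i) K"] T by simp
    also have "\<dots> = W i' @\<^sub>c Zl i * tr i"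
      using steps append_cols_mult_append_rows[OF Zl0 z t12(1,2)] t12(3) Zl0 z T0 WT0 by simp
    finally have "W i = Zl i * T i" using steps w_eq by simp
    then show ?thesis
      unfolding invar_def using W X Xs Lw steps Zl Sl Ll Cli Tc w_eq by simp
  qed
  have inv: "i \<le> N \<Longrightarrow> invar i" for i
  proof (induction i)
    case (Suc i)
    then show ?case using step[of "Suc i"] by simp
  qed (rule invar0)
  show ?thesis
  proof
    fix i assume i: "i \<in> {1..N}"
    then have "invar (i - 1)" by (intro inv) auto
    from step[OF i this] show "w i = Zl i * tr i \<and> W i = Zl i * T i"
      unfolding invar_def by blast
  qed
qed

end
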